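(* Let $m, n$ be positive integers with $m < n$, and let $k_2$ be an integer with $\lfloor \frac{m}{2} \rfloor \leq k_2 < m$. Then the number of ways to distribute $m$ identical balls into $n$ distinct boxes (empty boxes allowed) so that each box contains at most $k_2$ balls is $$\binom{m+n-1}{n-1} - \binom{n}{1} \binom{m - k_2 + n - 2}{n - 1}.$$
   Context: A distribution of $m$ identical balls into $n$ distinct boxes is an $n$-tuple $(X_1,\dots,X_n)$ of nonnegative integers with $X_1+\cdots+X_n=m$ (all balls are distributed with no remainder), where $X_i$ is the number of balls in box $i$. The number of ways is the number of such tuples satisfying the stated constraints. *)

theory Defs
  imports Main
begin

text \<open>
  An \<open>n\<close>-tuple is a list of length \<open>n\<close>; the entry \<open>X ! i\<close> is the number of balls in box
  \<open>i + 1\<close>, for \<open>i < n\<close>.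
\<close>

definition distributions :: "nat \<Rightarrow> nat \<Rightarrow> nat list set" where
  "distributions m n = {X. length X = n \<and> (\<Sum>i<n. X ! i) = m}"

end

theory Submission
  imports Defs
begin

text \<open>
  Since \<open>2 * (k\<^sub>2 + 1) > m\<close>, no distribution has two boxes with more than \<open>k\<^sub>2\<close> balls, so
  inclusion-exclusion stops after the first correction: the bad distributions split disjointly
  according to the unique overfull box, and removing \<open>k\<^sub>2 + 1\<close> balls from that box leaves an
  arbitrary distribution of the remaining balls.
\<close>

text \<open>Bridge to \<open>sum_list\<close>, the form in which stars and bars and the effect of a
  list update are available.\<close>

lemma distributions_conv_sum_list:
  "distributions m n = {X. length X = n \<and> sum_list X = m}"
  by (auto simp: distributions_def sum_list_sum_nth atLeast0LessThan)

lemma card_distributions: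
  assumes "0 < n"
  shows "card (distributions m n) = (m + n - 1) choose (n - 1)"
proof -
  have "card (distributions m n) = (m + n - 1) choose m"
    by (simp add: distributions_conv_sum_list card_length_sum_list)
  also have "\<dots> = (m + n - 1) choose (n - 1)"
    using assms binomial_symmetric[of m "m + n - 1"] by simp
  finally show ?thesis .
qed

lemma finite_distributions:
  "finite (distributions m n)"
proof (rule finite_subset)
  show "distributions m n \<subseteq> {X. set X \<subseteq> {..m} \<and> length X = n}"
    by (auto simp: distributions_conv_sum_list member_le_sum_list)
  show "finite {X. set X \<subseteq> {..m} \<and> length X = n}"
    by (rule finite_lists_length_eq) simp
qed

text \<open>Taking \<open>c\<close> balls out of box \<open>i\<close> is undone by putting them
  back. The bound \<open>c \<le> m\<close> keeps \<open>m - c\<close> from truncating: for larger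
  \<open>c\<close> the left side counts nothing, while \<open>distributions 0 n\<close> has one
  element.\<close>

lemma card_distributions_box_ge:
  assumes "i < n" and "c \<le> m"
  shows "card {X \<in> distributions m n. c \<le> X ! i} = card (distributions (m - c) n)"
proof (rule bij_betw_same_card)
  show "bij_betw (\<lambda>X. X[i := X ! i - c])
          {X \<in> distributions m n. c \<le> X ! i} (distributions (m - c) n)"
  proof (rule bij_betw_byWitness[where f' = "\<lambda>Y. Y[i := Y ! i + c]"])
    show "(\<lambda>X. X[i := X ! i - c]) ` {X \<in> distributions m n. c \<le> X ! i}
            \<subseteq> distributions (m - c) n"
      using assms by (auto simp: distributions_conv_sum_list sum_list_update)
    show "(\<lambda>Y. Y[i := Y ! i + c]) ` distributions (m - c) n
            \<subseteq> {X \<in> distributions m n. c \<le> X ! i}"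
      using assms by (auto simp: distributions_conv_sum_list sum_list_update)
  qed (use assms in \<open>auto simp: distributions_def\<close>)
qed

lemma two_boxes_le_total:
  assumes "X \<in> distributions m n" and "i < n" and "j < n" and "i \<noteq> j"
  shows "X ! i + X ! j \<le> m"
proof -
  have "X ! i + X ! j = (\<Sum>l\<in>{i, j}. X ! l)"
    using assms by simp
  also have "\<dots> \<le> (\<Sum>l<n. X ! l)"
    using assms by (intro sum_mono2) auto
  finally show ?thesis
    using assms by (simp add: distributions_def)
qed

theorem mainTheorem6:
  fixes m n k\<^sub>2 :: nat
  assumes "0 < m" and "0 < n" and "m < n"
    and "m div 2 \<le> k\<^sub>2" and "k\<^sub>2 < m"
  shows "int (card {X \<in> distributions m n. \<forall>i<n. X ! i \<le> k\<^sub>2}) =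
           int ((m + n - 1) choose (n - 1))
           - int (n choose 1) * int ((m - k\<^sub>2 + n - 2) choose (n - 1))"
proof -
  define good where "good = {X \<in> distributions m n. \<forall>i<n. X ! i \<le> k\<^sub>2}"
  define bad where "bad i = {X \<in> distributions m n. Suc k\<^sub>2 \<le> X ! i}" for i
  have fin: "finite good" "finite (bad i)" for i
    by (simp_all add: good_def bad_def finite_distributions)
  have card_bad: "card (bad i) = (m - k\<^sub>2 + n - 2) choose (n - 1)" if "i < n" for i
  proof -
    have "card (bad i) = (m - Suc k\<^sub>2 + n - 1) choose (n - 1)"
      using that assms by (simp add: bad_def card_distributions_box_ge card_distributions)
    \<comment> \<open>No subtraction truncates here, since \<open>k\<^sub>2 < m\<close> and
      \<open>0 < n\<close>.\<close>
    moreover have "m - Suc k\<^sub>2 + n - 1 = m - k\<^sub>2 + n - 2"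
      using assms by linarith
    ultimately show ?thesis by simp
  qed
  \<comment> \<open>From \<open>m div 2 \<le> k\<^sub>2\<close> follows
    \<open>m \<le> 2 * k\<^sub>2 + 1\<close>, one less than the least content of two overfull
    boxes.\<close>
  have disj: "bad i \<inter> bad j = {}" if "i < n" "j < n" "i \<noteq> j" for i j
    using two_boxes_le_total[OF _ that] assms(4) by (fastforce simp: bad_def)
  have "distributions m n = good \<union> (\<Union>i<n. bad i)"
    by (auto simp: good_def bad_def not_less_eq_eq)
  moreover have "good \<inter> (\<Union>i<n. bad i) = {}"
    by (auto simp: good_def bad_def not_less_eq_eq[symmetric])
  ultimately have "card (distributions m n) = card good + card (\<Union>i<n. bad i)"
    using fin by (simp add: card_Un_disjoint)
  also have "card (\<Union>i<n. bad i) = (\<Sum>i<n. card (bad i))"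
    using fin disj by (intro card_UN_disjoint) auto
  also have "\<dots> = n * ((m - k\<^sub>2 + n - 2) choose (n - 1))"
    using card_bad by simp
  \<comment> \<open>Kept additive over the naturals; the difference is formed only in
    \<open>int\<close>.\<close>
  finally have "(m + n - 1) choose (n - 1)
      = card good + n * ((m - k\<^sub>2 + n - 2) choose (n - 1))"
    using assms(2) by (simp add: card_distributions)
  then show ?thesis
    by (simp add: good_def)
qed

end
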